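(* Let $k,\ell,n$ be positive integers and let $\lambda\vdash n$ be an integer partition with number of parts $l(\lambda)=i$. The number of $\ell$-multichains $\mathcal P_1\leq\cdots\leq\mathcal P_\ell$ in $NC^{(k)}(n)$ whose bottom element has $k$-type $\lambda^{(k)}(\mathcal P_1)=\lambda$ is equal to $$\frac{(k\ell n)!}{m_\lambda\,(k\ell n-i+1)!}.$$
   Context: A partition of $[N]=\{1,\ldots,N\}$ is noncrossing if there are no $a<b<c<d$ with $a,c$ in one block and $b,d$ in a different block. $NC^{(k)}(n)$ is the poset, under refinement, of noncrossing partitions of $[kn]$ all of whose blocks have cardinality divisible by $k$. The $k$-type $\lambda^{(k)}(\mathcal P)$ of $\mathcal P\in NC^{(k)}(n)$ is the integer partition of $n$ whose parts are the numbers $|P|/k$ as $P$ runs over the blocks of $\mathcal P$. For an integer partition $\lambda$, $m_\lambda=m_1!\,m_2!\,m_3!\cdots$, where $m_j$ is the number of parts of $\lambda$ equal to $j$. *)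

theory Defs
  imports Complex_Main "HOL-Library.Multiset" "HOL-Library.Disjoint_Sets"
begin

definition noncrossing :: "nat set set \<Rightarrow> bool" where
  "noncrossing P \<longleftrightarrow>
    \<not> (\<exists>A\<in>P. \<exists>B\<in>P. A \<noteq> B \<and>
        (\<exists>a b c d. a < b \<and> b < c \<and> c < d \<and> a \<in> A \<and> c \<in> A \<and> b \<in> B \<and> d \<in> B))"

definition NC :: "nat \<Rightarrow> nat \<Rightarrow> nat set set set" where
  "NC k n = {P. partition_on {1..k * n} P \<and> noncrossing P \<and> (\<forall>B\<in>P. k dvd card B)}"

text \<open>
  Integer partitions are represented by the multiset of their (positive) parts,
  so that the length of a partition is \<open>size\<close> and the number of parts equal to
  \<open>j\<close> is \<open>count lam j\<close>.
\<close>

definition integer_partition :: "nat multiset \<Rightarrow> nat \<Rightarrow> bool" where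
  "integer_partition lam n \<longleftrightarrow> 0 \<notin># lam \<and> sum_mset lam = n"

text \<open>The division is exact for the blocks of members of \<open>NC k n\<close>.\<close>

definition ktype :: "nat \<Rightarrow> nat set set \<Rightarrow> nat multiset" where
  "ktype k P = image_mset (\<lambda>B. card B div k) (mset_set P)"

text \<open>Values \<open>j\<close> that do not occur as parts would only contribute factors \<open>0! = 1\<close>.\<close>

definition part_mult :: "nat multiset \<Rightarrow> nat" where
  "part_mult lam = (\<Prod>j\<in>set_mset lam. fact (count lam j))"

text \<open>
  \<open>refines A P Q\<close> says that every block of \<open>P\<close> lies in a block of \<open>Q\<close>, i.e. \<open>P \<le> Q\<close>;
  the head of a multichain is thus its bottom element.
\<close>

definition multichains :: "nat \<Rightarrow> nat \<Rightarrow> nat \<Rightarrow> nat set set list set" where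
  "multichains k n l =
    {Ps. length Ps = l \<and> set Ps \<subseteq> NC k n \<and> successively (refines {1..k * n}) Ps}"

end

theory Submission
  imports Defs "HOL-Library.FuncSet" "HOL-Computational_Algebra.Computational_Algebra"
    "HOL-Combinatorics.Multiset_Permutations"
begin

text \<open>
Give every block of size \<open>s\<close> of a noncrossing partition a weight \<open>w s\<close>, and let
\<open>A(x) = 1 + w 1 * x + w 2 * x^2 + \<dots>\<close>. Deciding on the block of the least point splits the
remaining points into independent gaps, which shows that the weighted number of noncrossing partitions
of \<open>N\<close> points has a generating function \<open>C\<close> with \<open>C(x) = A(x C(x))\<close> (\<open>ncsum_fps\<close>).

A multichain is built from the top by repeatedly partitioning every block. Hence the sum over all
multichains of the weight of the bottom element arises from the sum for single partitions by
substituting \<open>C\<close> for \<open>A\<close> again and again, and an induction gives \<open>G(x) = A(x G(x)^l)\<close> for its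
generating function \<open>G\<close> (\<open>chain_sum_fps\<close>). In other words, with respect to the block sizes of the
bottom element, multichains of length \<open>l\<close> behave like a single noncrossing partition of \<open>l * N\<close>
points with all block sizes divisible by \<open>l\<close>.

Lagrange inversion (\<open>Lagrange_coefficient\<close>) turns this equation into
\<open>(l N + 1) [x^N] G = [x^N] A^(l N + 1)\<close>. The weights are arbitrary, so the coefficients of
each monomial in them agree (\<open>count_eq_of_weighted_sums_eq\<close>): \<open>l N + 1\<close> times the number of
multichains with bottom block sizes \<open>\<mu>\<close> is the number of arrangements of the parts of \<open>\<mu>\<close>
together with zeros in a list of length \<open>l N + 1\<close>, which is a multinomial coefficient.

Finally, the parameter \<open>k\<close> is absorbed by taking \<open>N = k n\<close> and \<open>\<mu>\<close> to be the partition with parts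
\<open>k * s\<close>, \<open>s\<close> in \<open>lam\<close> (\<open>multichains_ktype_eq\<close>).
\<close>

unbundle fps_syntax

section \<open>Noncrossing partitions and multiplicative weights\<close>

definition ncp :: "nat set \<Rightarrow> nat set set set" where
  "ncp S = {P. partition_on S P \<and> noncrossing P}"

lemma noncrossingI:
  assumes "\<And>A B a b c d. \<lbrakk>A \<in> P; B \<in> P; A \<noteq> B; a < b; b < c; c < d; a \<in> A; c \<in> A; b \<in> B; d \<in> B\<rbrakk> \<Longrightarrow> False"
  shows "noncrossing P"
  unfolding noncrossing_def
proof clarify
  fix A B a b c d
  assume "A \<in> P" "B \<in> P" "A \<noteq> B" "a < b" "b < c" "c < d" "a \<in> A" "c \<in> A" "b \<in> B" "d \<in> B"
  then show False by (rule assms)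
qed

lemma noncrossingD:
  assumes "noncrossing P" "A \<in> P" "B \<in> P" "A \<noteq> B" "a < b" "b < c" "c < d"
    "a \<in> A" "c \<in> A" "b \<in> B" "d \<in> B"
  shows False
proof (rule notE[OF assms(1)[unfolded noncrossing_def]], rule bexI[OF _ assms(2)], rule bexI[OF _ assms(3)])
  show "A \<noteq> B \<and> (\<exists>a b c d. a < b \<and> b < c \<and> c < d \<and> a \<in> A \<and> c \<in> A \<and> b \<in> B \<and> d \<in> B)"
    by (rule conjI[OF assms(4)], rule exI[of _ a], rule exI[of _ b], rule exI[of _ c], rule exI[of _ d])
      (simp add: assms)
qed

lemma noncrossing_subset:
  assumes "noncrossing P" "Q \<subseteq> P"
  shows "noncrossing Q"
proof (rule noncrossingI)
  fix A B a b c d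
  assume "A \<in> Q" "B \<in> Q" and *: "A \<noteq> B" "a < b" "b < c" "c < d" "a \<in> A" "c \<in> A" "b \<in> B" "d \<in> B"
  then show False using noncrossingD[OF assms(1) _ _ *] assms(2) by auto
qed

definition ncsum :: "(nat \<Rightarrow> real) \<Rightarrow> nat set \<Rightarrow> real" where
  "ncsum w S = (\<Sum>P\<in>ncp S. \<Prod>B\<in>P. w (card B))"

lemma finite_ncp: "finite S \<Longrightarrow> finite (ncp S)"
  unfolding ncp_def by (rule finite_subset[OF _ finitely_many_partition_on]) auto

lemma ncp_empty: "ncp {} = {{}}"
  by (auto simp: ncp_def partition_on_empty noncrossing_def)

text \<open>
The sets \<open>A i\<close> are what the blocks of a noncrossing partition may be confined to independently
of each other: no pair of points of one set crosses a pair of points of another. The blocks of a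
noncrossing partition and the gaps between the elements of a block are the two instances.
\<close>

definition noncrossing_family :: "('i \<Rightarrow> nat set) \<Rightarrow> 'i set \<Rightarrow> bool" where
  "noncrossing_family A I \<longleftrightarrow>
    (\<forall>i\<in>I. \<forall>j\<in>I. \<forall>a b c d. i \<noteq> j \<longrightarrow> a < b \<longrightarrow> b < c \<longrightarrow> c < d \<longrightarrow>
      a \<in> A i \<longrightarrow> c \<in> A i \<longrightarrow> b \<in> A j \<longrightarrow> d \<in> A j \<longrightarrow> False)"

lemma noncrossing_familyI:
  assumes "\<And>i j a b c d. \<lbrakk>i \<in> I; j \<in> I; i \<noteq> j; a < b; b < c; c < d;
    a \<in> A i; c \<in> A i; b \<in> A j; d \<in> A j\<rbrakk> \<Longrightarrow> False"
  shows "noncrossing_family A I"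
  unfolding noncrossing_family_def by (intro ballI allI impI) (rule assms)

lemma noncrossing_familyD:
  assumes "noncrossing_family A I" "i \<in> I" "j \<in> I" "i \<noteq> j" "a < b" "b < c" "c < d"
    "a \<in> A i" "c \<in> A i" "b \<in> A j" "d \<in> A j"
  shows False
  using assms(1)[unfolded noncrossing_family_def, rule_format, OF assms(2-11)] .

text \<open>
A noncrossing partition all of whose blocks stay inside the sets \<open>A i\<close> is the same thing as one
noncrossing partition of each \<open>A i\<close>, because a crossing of two blocks from different sets would be a
crossing of those sets. Weights are multiplicative over blocks, so their sums multiply.
The decomposition by the block of the least point and the refinement of a given partition are both
instances of this factorization.
\<close>

lemma sum_ncp_within:
  fixes A :: "'i \<Rightarrow> nat set" and g :: "nat set \<Rightarrow> 'a::comm_semiring_1"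
  assumes I: "finite I" and fin: "\<And>i. i \<in> I \<Longrightarrow> finite (A i)"
    and disj: "disjoint_family_on A I" and nc: "noncrossing_family A I"
  shows "(\<Sum>P | P \<in> ncp (\<Union>i\<in>I. A i) \<and> (\<forall>B\<in>P. \<exists>i\<in>I. B \<subseteq> A i). \<Prod>B\<in>P. g B) =
    (\<Prod>i\<in>I. \<Sum>P\<in>ncp (A i). \<Prod>B\<in>P. g B)"
proof -
  let ?glue = "\<lambda>F. \<Union>i\<in>I. F i"
  let ?part = "\<lambda>P. \<lambda>i\<in>I. {B \<in> P. B \<subseteq> A i}"
  have ne: "B \<noteq> {}" "B \<subseteq> A i" if "F \<in> PiE I (\<lambda>i. ncp (A i))" "i \<in> I" "B \<in> F i" for F i B
    using that by (auto simp: PiE_iff ncp_def partition_on_def)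
  have uniq: "i = j" if "i \<in> I" "j \<in> I" "B \<subseteq> A i" "B \<subseteq> A j" "B \<noteq> {}" for i j B
    using that disj by (fastforce simp: disjoint_family_on_def)
  have "(\<Prod>i\<in>I. \<Sum>P\<in>ncp (A i). \<Prod>B\<in>P. g B) = (\<Sum>F\<in>PiE I (\<lambda>i. ncp (A i)). \<Prod>i\<in>I. \<Prod>B\<in>F i. g B)"
    by (rule prod_sum_PiE) (auto simp: I fin finite_ncp)
  also have "\<dots> = (\<Sum>P | P \<in> ncp (\<Union>i\<in>I. A i) \<and> (\<forall>B\<in>P. \<exists>i\<in>I. B \<subseteq> A i). \<Prod>B\<in>P. g B)"
  proof (rule sum.reindex_bij_witness[where i = ?part and j = ?glue], goal_cases)
    case (1 F)
    show ?case
    proof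
      fix i show "?part (?glue F) i = F i"
      proof (cases "i \<in> I")
        case True
        have "B \<in> F i" if "B \<in> F j" "j \<in> I" "B \<subseteq> A i" for B j
          using uniq[of i j B] ne[OF 1 that(2,1)] that True by auto
        then have "{B \<in> ?glue F. B \<subseteq> A i} = F i"
          using True ne(2)[OF 1 True] by (intro equalityI subsetI CollectI conjI) blast+
        then show ?thesis using True by simp
      qed (use 1 in \<open>auto simp: PiE_iff extensional_def\<close>)
    qed
  next
    case (2 F)
    have part: "partition_on (A i) (F i)" "noncrossing (F i)" if "i \<in> I" for i
      using 2 that by (auto simp: PiE_iff ncp_def)
    have "partition_on (\<Union>i\<in>I. A i) (?glue F)"
    proof (rule partition_onI)
      show "\<Union>(?glue F) = (\<Union>i\<in>I. A i)"
        using partition_onD1[OF part(1)] by blast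
      show "{} \<notin> ?glue F" using part(1) by (auto simp: partition_on_def)
      fix B C assume B: "B \<in> ?glue F" and C: "C \<in> ?glue F" and "B \<noteq> C"
      from B C obtain i j where ij: "i \<in> I" "j \<in> I" "B \<in> F i" "C \<in> F j" by auto
      show "disjnt B C"
      proof (cases "i = j")
        case True
        then show ?thesis using part(1)[OF ij(1)] ij \<open>B \<noteq> C\<close>
          by (auto simp: partition_on_def pairwise_def)
      next
        case False
        then have "A i \<inter> A j = {}" using disj ij by (auto simp: disjoint_family_on_def)
        then show ?thesis using ne(2)[OF 2 ij(1,3)] ne(2)[OF 2 ij(2,4)] by (auto simp: disjnt_def)
      qed
    qed
    moreover have "noncrossing (?glue F)"
    proof (rule noncrossingI)
      fix B C a b c d
      assume BC: "B \<in> ?glue F" "C \<in> ?glue F" and *: "B \<noteq> C" "a < b" "b < c" "c < d"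
        "a \<in> B" "c \<in> B" "b \<in> C" "d \<in> C"
      from BC obtain i j where ij: "i \<in> I" "j \<in> I" "B \<in> F i" "C \<in> F j" by auto
      show False
      proof (cases "i = j")
        case True
        then show ?thesis using noncrossingD[OF part(2)[OF ij(1)] ij(3) _ *] ij(4) by blast
      next
        case False
        have "B \<subseteq> A i" "C \<subseteq> A j" using ne(2)[OF 2] ij by auto
        then have "a \<in> A i" "c \<in> A i" "b \<in> A j" "d \<in> A j" using * by auto
        then show ?thesis using noncrossing_familyD[OF nc ij(1,2) False *(2-4)] by simp
      qed
    qed
    ultimately show ?case using ne(2)[OF 2] by (auto simp: ncp_def)
  next
    case (3 P)
    then show ?case by auto
  next
    case (4 P)
    then have P: "partition_on (\<Union>i\<in>I. A i) P" "noncrossing P" "\<And>B. B \<in> P \<Longrightarrow> \<exists>i\<in>I. B \<subseteq> A i"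
      by (auto simp: ncp_def)
    have "{B \<in> P. B \<subseteq> A i} \<in> ncp (A i)" if i: "i \<in> I" for i
    proof -
      have "partition_on (A i) {B \<in> P. B \<subseteq> A i}"
      proof (rule partition_onI)
        show "\<Union>{B \<in> P. B \<subseteq> A i} = A i"
        proof (intro equalityI subsetI)
          fix x assume x: "x \<in> A i"
          then obtain B where B: "B \<in> P" "x \<in> B" using P(1) i by (auto simp: partition_on_def)
          obtain j where j: "j \<in> I" "B \<subseteq> A j" using P(3)[OF B(1)] by auto
          have "j = i" using disj j i x B by (auto simp: disjoint_family_on_def)
          then show "x \<in> \<Union>{B \<in> P. B \<subseteq> A i}" using B j by auto
        qed blast
      qed (use P(1) in \<open>auto simp: partition_on_def pairwise_def\<close>)
      moreover have "noncrossing {B \<in> P. B \<subseteq> A i}"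
        using P(2) by (rule noncrossing_subset) auto
      ultimately show ?thesis by (simp add: ncp_def)
    qed
    then show ?case by auto
  next
    case (5 F)
    show ?case
    proof (rule prod.UNION_disjoint[OF I])
      show "\<forall>i\<in>I. finite (F i)"
        using 5 fin by (auto simp: PiE_iff ncp_def intro: finite_elements)
      show "\<forall>i\<in>I. \<forall>j\<in>I. i \<noteq> j \<longrightarrow> F i \<inter> F j = {}"
      proof (intro ballI impI equals0I)
        fix i j B assume ij: "i \<in> I" "j \<in> I" "i \<noteq> j" and B: "B \<in> F i \<inter> F j"
        then show False using uniq[OF ij(1,2), of B] ne[OF 5 ij(1), of B] ne[OF 5 ij(2), of B] by simp
      qed
    qed
  qed
  finally show ?thesis by simp
qed

section \<open>Decomposition by the block of the least point\<close>

text \<open>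
Elements of \<open>X\<close> are excluded
automatically, since \<open>s \<in> X\<close> with \<open>x < s\<close> would have to satisfy \<open>s < s\<close>.
\<close>

definition gap :: "nat set \<Rightarrow> nat set \<Rightarrow> nat \<Rightarrow> nat set" where
  "gap S X x = {s \<in> S. x < s \<and> (\<forall>y\<in>X. x < y \<longrightarrow> s < y)}"

lemma gap_cover:
  assumes "finite X" "a \<in> X" "\<And>s. s \<in> S \<Longrightarrow> a \<le> s"
  shows "(\<Union>x\<in>X. gap S X x) = S - X"
proof
  show "(\<Union>x\<in>X. gap S X x) \<subseteq> S - X" by (auto simp: gap_def)
  show "S - X \<subseteq> (\<Union>x\<in>X. gap S X x)"
  proof
    fix s assume s: "s \<in> S - X"
    define x where "x = Max {y \<in> X. y < s}"
    have "a \<in> {y \<in> X. y < s}" using assms s by (auto simp: order_less_le)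
    then have x: "x \<in> {y \<in> X. y < s}" unfolding x_def using assms(1) by (intro Max_in) auto
    have "s < y" if "y \<in> X" "x < y" for y
    proof (rule ccontr)
      assume "\<not> s < y"
      then have "y < s" using s that by (metis Diff_iff linorder_neqE_nat)
      then have "y \<le> x" unfolding x_def using assms(1) that by (intro Max_ge) auto
      then show False using that by simp
    qed
    then show "s \<in> (\<Union>x\<in>X. gap S X x)" using x s by (auto simp: gap_def)
  qed
qed

lemma disjoint_gaps: "disjoint_family_on (gap S X) X"
proof -
  have "gap S X x \<inter> gap S X y = {}" if "x \<in> X" "y \<in> X" "x < y" for x y
    using that by (force simp: gap_def)
  then show ?thesis unfolding disjoint_family_on_def by (metis inf_commute linorder_neqE_nat)
qed

lemma noncrossing_gaps: "noncrossing_family (gap S X) X"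
proof -
  have *: "a < b" if "x \<in> X" "y \<in> X" "x < y" "a \<in> gap S X x" "b \<in> gap S X y" for x y a b
    using that by (force simp: gap_def)
  show ?thesis
  proof (rule noncrossing_familyI)
    fix x y a b c d
    assume "x \<in> X" "y \<in> X" "x \<noteq> y" "a < b" "b < c" "c < d"
      "a \<in> gap S X x" "c \<in> gap S X x" "b \<in> gap S X y" "d \<in> gap S X y"
    then show False using *[of x y c b] *[of y x b a] by (cases "x < y") auto
  qed
qed

text \<open>
A block \<open>B\<close> with points \<open>b < c\<close> in the gaps after \<open>x\<close> and after \<open>y > x\<close> would give the crossing
\<open>x < b < y < c\<close>; conversely a block inside one gap has no element of \<open>X\<close> between its points.
Since \<open>X\<close> contains the least point, no point of \<open>S - X\<close> precedes all of \<open>X\<close>, so that the gaps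
cover \<open>S - X\<close>.
\<close>

lemma noncrossing_insert_iff_gaps:
  assumes X: "finite X" "a \<in> X" "X \<subseteq> S" "\<And>s. s \<in> S \<Longrightarrow> a \<le> s"
    and Q: "partition_on (S - X) Q"
  shows "noncrossing (insert X Q) \<longleftrightarrow> noncrossing Q \<and> (\<forall>B\<in>Q. \<exists>x\<in>X. B \<subseteq> gap S X x)"
proof safe
  assume nc: "noncrossing (insert X Q)"
  then show "noncrossing Q" by (rule noncrossing_subset) auto
  fix B assume B: "B \<in> Q"
  have BS: "B \<subseteq> S - X" "B \<noteq> {}" using Q B by (auto simp: partition_on_def)
  then obtain b where b: "b \<in> B" by auto
  have "b \<in> (\<Union>x\<in>X. gap S X x)" using b BS gap_cover[OF X(1,2,4)] by auto
  then obtain x where x: "x \<in> X" "b \<in> gap S X x" by auto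
  have "c \<in> gap S X x" if c: "c \<in> B" for c
  proof -
    have "c \<in> S - X" using c BS by auto
    then obtain y where y: "y \<in> X" "c \<in> gap S X y" using gap_cover[OF X(1,2,4)] by blast
    have BX: "B \<noteq> X" using BS by auto
    have crossing: False if "x \<in> X" "y \<in> X" "b \<in> B" "c \<in> B" "x < y" "b \<in> gap S X x" "c \<in> gap S X y"
      for x y b c
    proof -
      have "x < b" "b < y" "y < c" using that by (auto simp: gap_def)
      then show False using noncrossingD[OF nc, of X B x b y c] that B BX by auto
    qed
    have "x = y" using crossing[of x y b c] crossing[of y x c b] x y b c by force
    then show ?thesis using y by simp
  qed
  then show "\<exists>x\<in>X. B \<subseteq> gap S X x" using x(1) by blast
next
  assume ncQ: "noncrossing Q" and within: "\<forall>B\<in>Q. \<exists>x\<in>X. B \<subseteq> gap S X x"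
  have no: False if B: "B \<in> Q" and bd: "b \<in> B" "d \<in> B" "b < c" "c < d" "c \<in> X" for B b c d
  proof -
    obtain x where "x \<in> X" "B \<subseteq> gap S X x" using within B by auto
    then have "x < b" "\<forall>y\<in>X. x < y \<longrightarrow> d < y" using bd by (auto simp: gap_def)
    then show False using bd by fastforce
  qed
  show "noncrossing (insert X Q)"
  proof (rule noncrossingI)
    fix A B a b c d
    assume *: "A \<in> insert X Q" "B \<in> insert X Q" "A \<noteq> B" "a < b" "b < c" "c < d"
      "a \<in> A" "c \<in> A" "b \<in> B" "d \<in> B"
    then consider "A = X" "B \<in> Q" | "A \<in> Q" "B = X" | "A \<in> Q" "B \<in> Q" by auto
    then show False
    proof cases
      case 1 then show ?thesis using no[of B b d c] * by auto
    next
      case 2 then show ?thesis using no[of A a c b] * by auto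
    next
      case 3 then show ?thesis using noncrossingD[OF ncQ _ _ *(3-)] by blast
    qed
  qed
qed

text \<open>
Choosing the block \<open>X\<close> of the least point \<open>a\<close> leaves independent noncrossing partitions of the gaps
of \<open>X\<close>.
\<close>

lemma ncsum_by_first_block:
  assumes S: "finite S" "a \<in> S" "\<And>s. s \<in> S \<Longrightarrow> a \<le> s"
  shows "ncsum w S = (\<Sum>X | X \<subseteq> S \<and> a \<in> X. w (card X) * (\<Prod>x\<in>X. ncsum w (gap S X x)))"
proof -
  let ?g = "\<lambda>B::nat set. w (card B)"
  have "ncsum w S = (\<Sum>X | X \<subseteq> S \<and> a \<in> X. \<Sum>P | P \<in> ncp S \<and> X \<in> P. \<Prod>B\<in>P. ?g B)"
  proof -
    have *: "\<exists>X. {Y. Y \<in> {X. X \<subseteq> S \<and> a \<in> X} \<and> Y \<in> P} = {X}" if P: "P \<in> ncp S" for P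
    proof -
      have part: "\<Union>P = S" "disjoint P" using P by (auto simp: ncp_def partition_on_def)
      then obtain X where X: "X \<in> P" "a \<in> X" using S(2) by blast
      have uniq: "Y = X" if "Y \<in> P" "a \<in> Y" for Y
        using disjointD[OF part(2) that(1) X(1)] that(2) X(2) by blast
      have "X \<subseteq> S" using X(1) part(1) by blast
      then have "{Y. Y \<in> {X. X \<subseteq> S \<and> a \<in> X} \<and> Y \<in> P} = {X}"
        using X uniq by blast
      then show ?thesis by blast
    qed
    have "(\<Sum>X | X \<subseteq> S \<and> a \<in> X. \<Sum>P | P \<in> ncp S \<and> X \<in> P. \<Prod>B\<in>P. ?g B) =
      (\<Sum>P\<in>ncp S. \<Sum>X | X \<in> {X. X \<subseteq> S \<and> a \<in> X} \<and> X \<in> P. \<Prod>B\<in>P. ?g B)"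
      by (subst sum.swap_restrict) (auto simp: S finite_ncp)
    also have "\<dots> = (\<Sum>P\<in>ncp S. \<Prod>B\<in>P. ?g B)"
    proof (rule sum.cong[OF refl])
      fix P assume "P \<in> ncp S"
      then obtain X where "{Y. Y \<in> {X. X \<subseteq> S \<and> a \<in> X} \<and> Y \<in> P} = {X}" using * by blast
      then show "(\<Sum>X | X \<in> {X. X \<subseteq> S \<and> a \<in> X} \<and> X \<in> P. \<Prod>B\<in>P. ?g B) = (\<Prod>B\<in>P. ?g B)"
        by (simp only: sum.insert finite.emptyI sum.empty empty_iff if_False not_False_eq_True add_0_right)
    qed
    finally show ?thesis by (simp add: ncsum_def)
  qed
  also have "\<dots> = (\<Sum>X | X \<subseteq> S \<and> a \<in> X. w (card X) * (\<Prod>x\<in>X. ncsum w (gap S X x)))"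
  proof (rule sum.cong[OF refl], clarify)
    fix X assume X: "X \<subseteq> S" "a \<in> X"
    have finX: "finite X" using X S(1) finite_subset by auto
    have cover: "(\<Union>x\<in>X. gap S X x) = S - X" by (rule gap_cover[OF finX X(2) S(3)])
    let ?Q = "{Q. Q \<in> ncp (\<Union>x\<in>X. gap S X x) \<and> (\<forall>B\<in>Q. \<exists>x\<in>X. B \<subseteq> gap S X x)}"
    have notin: "X \<notin> Q" if "partition_on (S - X) Q" for Q
      using that X by (auto simp: partition_on_def)
    have part: "partition_on S (insert X Q)" if "partition_on (S - X) Q" for Q
      using partition_on_insert[of X Q S] that X by (auto simp: partition_on_def disjnt_def)
    have part': "partition_on (S - X) (P - {X})" if "partition_on S P" "X \<in> P" for P
    proof -
      have "disjnt X (\<Union>(P - {X}))" using that by (auto simp: partition_on_def pairwise_def disjnt_def)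
      then show ?thesis using partition_on_insert[of X "P - {X}" S] that by (simp add: insert_absorb)
    qed
    have iff: "noncrossing (insert X Q) \<longleftrightarrow> noncrossing Q \<and> (\<forall>B\<in>Q. \<exists>x\<in>X. B \<subseteq> gap S X x)"
      if "partition_on (S - X) Q" for Q
      using noncrossing_insert_iff_gaps[OF finX X(2,1) _ that] S(3) by blast
    have "(\<Sum>P | P \<in> ncp S \<and> X \<in> P. \<Prod>B\<in>P. ?g B) = (\<Sum>Q\<in>?Q. \<Prod>B\<in>insert X Q. ?g B)"
    proof (rule sum.reindex_bij_witness[where i = "insert X" and j = "\<lambda>P. P - {X}"], goal_cases)
      case (2 P)
      then have P: "partition_on S P" "noncrossing P" "X \<in> P" by (auto simp: ncp_def)
      then show ?case using iff[OF part'[OF P(1,3)]] part'[OF P(1,3)]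
        by (auto simp: cover ncp_def insert_absorb)
    next
      case (4 Q)
      then show ?case using iff part by (auto simp: cover ncp_def)
    qed (auto simp: cover ncp_def insert_absorb dest: notin)
    also have "\<dots> = (\<Sum>Q\<in>?Q. ?g X * (\<Prod>B\<in>Q. ?g B))"
    proof (rule sum.cong[OF refl])
      fix Q assume "Q \<in> ?Q"
      then have "partition_on (S - X) Q" by (simp add: cover ncp_def)
      moreover from this have "finite Q" using finite_elements S(1) by blast
      ultimately show "(\<Prod>B\<in>insert X Q. ?g B) = ?g X * (\<Prod>B\<in>Q. ?g B)" using notin by simp
    qed
    also have "\<dots> = ?g X * (\<Prod>x\<in>X. ncsum w (gap S X x))"
      unfolding sum_distrib_left[symmetric] ncsum_def
      by (subst sum_ncp_within[OF finX _ disjoint_gaps noncrossing_gaps])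
        (use S in \<open>auto simp: gap_def\<close>)
    finally show "(\<Sum>P | P \<in> ncp S \<and> X \<in> P. \<Prod>B\<in>P. ?g B) = w (card X) * (\<Prod>x\<in>X. ncsum w (gap S X x))" .
  qed
  finally show ?thesis .
qed

section \<open>The generating function of noncrossing partitions\<close>

lemma bij_betw_rank:
  fixes T :: "nat set"
  assumes "finite T"
  shows "bij_betw (\<lambda>m. card (T \<inter> {..<m})) T {..<card T}"
proof -
  let ?r = "\<lambda>m. card (T \<inter> {..<m})"
  have mono: "?r m < ?r m'" if "m \<in> T" "m < m'" for m m'
    using that assms by (intro psubset_card_mono) auto
  have inj: "inj_on ?r T"
    by (rule linorder_inj_onI) (auto dest: mono)
  moreover have "?r ` T \<subseteq> {..<card T}"
    using assms by (auto intro!: psubset_card_mono)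
  ultimately have "?r ` T = {..<card T}"
    by (intro card_subset_eq) (auto simp: card_image)
  with inj show ?thesis by (simp add: bij_betw_def)
qed

lemma card_above:
  fixes T :: "nat set"
  assumes "finite T" "m \<in> T"
  shows "card (T \<inter> {m<..}) = card T - 1 - card (T \<inter> {..<m})"
proof -
  have "T = insert m ((T \<inter> {..<m}) \<union> (T \<inter> {m<..}))" using assms(2) by auto
  then have "card T = card (insert m ((T \<inter> {..<m}) \<union> (T \<inter> {m<..})))" by simp
  also have "\<dots> = Suc (card ((T \<inter> {..<m}) \<union> (T \<inter> {m<..})))"
    using assms(1) by (intro card_insert_disjoint) auto
  also have "card ((T \<inter> {..<m}) \<union> (T \<inter> {m<..})) = card (T \<inter> {..<m}) + card (T \<inter> {m<..})"
    using assms(1) by (intro card_Un_disjoint) auto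
  finally show ?thesis by simp
qed

lemma sum_nonempty_subsets_by_Min:
  fixes T :: "nat set" and f :: "nat set \<Rightarrow> 'a::comm_monoid_add"
  assumes "finite T"
  shows "(\<Sum>X\<in>Pow T - {{}}. f X) = (\<Sum>m\<in>T. \<Sum>X\<in>Pow (T \<inter> {m<..}). f (insert m X))"
proof -
  have "(\<Sum>m\<in>T. \<Sum>X\<in>Pow (T \<inter> {m<..}). f (insert m X)) =
    (\<Sum>(m, X)\<in>(SIGMA m:T. Pow (T \<inter> {m<..})). f (insert m X))"
    using assms by (subst sum.Sigma) auto
  also have "\<dots> = (\<Sum>X\<in>Pow T - {{}}. f X)"
  proof (rule sum.reindex_bij_witness[where i = "\<lambda>X. (Min X, X - {Min X})" and j = "\<lambda>(m, X). insert m X"],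
      goal_cases)
    case (1 p)
    then obtain m X where p: "p = (m, X)" "m \<in> T" "X \<subseteq> T \<inter> {m<..}" by auto
    have "finite X" using p(3) assms by (meson finite_Int finite_subset)
    then have "Min (insert m X) = m" using p(3) by (intro Min_eqI) auto
    moreover have "m \<notin> X" using p(3) by auto
    ultimately show ?case using p by simp
  next
    case (4 X)
    then have X: "finite X" "X \<noteq> {}" "X \<subseteq> T" using assms finite_subset by auto
    have "x > Min X" if "x \<in> X" "x \<noteq> Min X" for x
      using Min_le[OF X(1) that(1)] that(2) by simp
    moreover have "Min X \<in> T" using Min_in[OF X(1,2)] X(3) by auto
    ultimately show ?case using X(3) by auto
  next
    case (3 X)
    then have X: "finite X" "X \<noteq> {}" using assms finite_subset by auto
    then show ?case by (simp add: insert_absorb)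
  qed auto
  finally show ?thesis by simp
qed

text \<open>
If the weight of a gap depends only on its size, then summing over all blocks \<open>insert a X\<close> is a power
series calculation: a block of \<open>s + 1\<close> elements is a sequence of \<open>s + 1\<close> gaps separated by \<open>s\<close>
elements, which contributes \<open>u s * x^s * H^(s+1)\<close>. The induction peels off one gap at a time: the
least element \<open>m\<close> of \<open>X\<close> ends the gap of \<open>a\<close>, and then takes over the role of \<open>a\<close> for the points
above it, with \<open>u\<close> shifted by one.
\<close>

lemma gap_sum_fps:
  fixes u h :: "nat \<Rightarrow> real" and T :: "nat set"
  assumes "finite T" "\<And>t. t \<in> T \<Longrightarrow> a < t"
  shows "(\<Sum>X\<in>Pow T. u (card X) * (\<Prod>x\<in>insert a X. h (card (gap T (insert a X) x)))) =
    (Abs_fps h * (Abs_fps u oo (fps_X * Abs_fps h))) $ card T"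
  using assms
proof (induction "card T" arbitrary: T u a rule: less_induct)
  case less
  let ?H = "Abs_fps h" 
  let ?f = "\<lambda>X. u (card X) * (\<Prod>x\<in>insert a X. h (card (gap T (insert a X) x)))"
  let ?r = "\<lambda>m. card (T \<inter> {..<m})"
  define K where "K = ?H * (Abs_fps (u \<circ> Suc) oo (fps_X * ?H))"
  have f_insert: "(\<Sum>X\<in>Pow (T \<inter> {m<..}). ?f (insert m X)) = h (?r m) * K $ (card T - 1 - ?r m)"
    if m: "m \<in> T" for m
  proof -
    let ?T = "T \<inter> {m<..}"
    have "?f (insert m X) =
      h (?r m) * ((u \<circ> Suc) (card X) * (\<Prod>x\<in>insert m X. h (card (gap ?T (insert m X) x))))"
      if X: "X \<in> Pow ?T" for X
    proof -
      have finX: "finite X" using X less.prems(1) by (meson PowD finite_Int finite_subset)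
      have mX: "m \<notin> X" using X by auto
      have aX: "a \<notin> insert m X" using X less.prems(2) m by fastforce
      have g1: "gap T (insert a (insert m X)) a = T \<inter> {..<m}"
        using less.prems(2) X m by (fastforce simp: gap_def)
      have g2: "gap T (insert a (insert m X)) x = gap ?T (insert m X) x" if "x \<in> insert m X" for x
        using that less.prems(2) X m by (fastforce simp: gap_def)
      have "(\<Prod>x\<in>insert a (insert m X). h (card (gap T (insert a (insert m X)) x))) =
        h (?r m) * (\<Prod>x\<in>insert m X. h (card (gap T (insert a (insert m X)) x)))"
        using finX aX g1 by (subst prod.insert) auto
      also have "(\<Prod>x\<in>insert m X. h (card (gap T (insert a (insert m X)) x))) =
        (\<Prod>x\<in>insert m X. h (card (gap ?T (insert m X) x)))"
        by (rule prod.cong) (auto simp: g2)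
      finally show ?thesis using finX mX by (simp del: prod.insert)
    qed
    then have "(\<Sum>X\<in>Pow ?T. ?f (insert m X)) = h (?r m) *
      (\<Sum>X\<in>Pow ?T. (u \<circ> Suc) (card X) * (\<Prod>x\<in>insert m X. h (card (gap ?T (insert m X) x))))"
      by (simp only: sum_distrib_left cong: sum.cong)
    also have "(\<Sum>X\<in>Pow ?T. (u \<circ> Suc) (card X) * (\<Prod>x\<in>insert m X. h (card (gap ?T (insert m X) x)))) =
      K $ card ?T"
      unfolding K_def
      by (rule less.hyps) (use less.prems(1) m in \<open>auto intro!: psubset_card_mono\<close>)
    also have "card ?T = card T - 1 - ?r m" by (rule card_above[OF less.prems(1) m])
    finally show ?thesis .
  qed
  have gap0: "gap T {a} a = T" using less.prems(2) by (auto simp: gap_def)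
  have "(\<Sum>X\<in>Pow T. ?f X) = ?f {} + (\<Sum>X\<in>Pow T - {{}}. ?f X)"
    using less.prems(1) by (intro sum.remove) auto
  also have "?f {} = u 0 * h (card T)" by (simp add: gap0)
  also have "(\<Sum>X\<in>Pow T - {{}}. ?f X) = (\<Sum>m\<in>T. h (?r m) * K $ (card T - 1 - ?r m))"
    by (subst sum_nonempty_subsets_by_Min[OF less.prems(1)], rule sum.cong[OF refl], rule f_insert)
  also have "\<dots> = (\<Sum>g<card T. h g * K $ (card T - 1 - g))"
    by (rule sum.reindex_bij_betw[OF bij_betw_rank[OF less.prems(1)]])
  also have "\<dots> = (fps_X * (?H * K)) $ card T"
    by (cases "card T") (auto simp: fps_mult_nth[of ?H] lessThan_Suc_atMost atMost_atLeast0)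
  also have "u 0 * h (card T) = (fps_const (u 0) * ?H) $ card T" by simp
  also have "\<dots> + (fps_X * (?H * K)) $ card T = (fps_const (u 0) * ?H + fps_X * (?H * K)) $ card T"
    by simp
  also have "fps_const (u 0) * ?H + fps_X * (?H * K) = ?H * (Abs_fps u oo (fps_X * ?H))"
  proof -
    have "Abs_fps u = fps_const (u 0) + fps_X * Abs_fps (u \<circ> Suc)"
      by (rule fps_ext) (simp add: gr0_conv_Suc split: nat.split)
    then have "Abs_fps u oo (fps_X * ?H) =
        fps_const (u 0) + fps_X * ?H * (Abs_fps (u \<circ> Suc) oo (fps_X * ?H))"
      by (simp add: fps_compose_add_distrib fps_compose_mult_distrib)
    then show ?thesis by (simp add: K_def algebra_simps)
  qed
  finally show ?case .
qed

text \<open>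
The constant term 1 lets a zero in a list of sizes stand for an absent block.
\<close>

definition weight_fps :: "(nat \<Rightarrow> real) \<Rightarrow> real fps" where
  "weight_fps w = Abs_fps (\<lambda>s. if s = 0 then 1 else w s)"

lemma ncsum_empty: "ncsum w {} = 1"
  by (simp add: ncsum_def ncp_empty)

text \<open>
The hypothesis on proper subsets is what an induction on the size of \<open>S\<close> provides; the conclusion
then shows that \<open>ncsum w S\<close>, too, depends only on \<open>card S\<close>.
\<close>

lemma ncsum_recurrence:
  assumes S: "finite S" "S \<noteq> {}" and h: "\<And>R. R \<subset> S \<Longrightarrow> ncsum w R = h (card R)"
  shows "ncsum w S = (Abs_fps h * (Abs_fps (w \<circ> Suc) oo (fps_X * Abs_fps h))) $ (card S - 1)"
proof -
  define a where "a = Min S"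
  define T where "T = S - {a}"
  have a: "a \<in> S" "\<And>s. s \<in> S \<Longrightarrow> a \<le> s" using S by (auto simp: a_def)
  have T: "finite T" "\<And>t. t \<in> T \<Longrightarrow> a < t" "a \<notin> T" "S = insert a T"
    using S a by (auto simp: T_def order_less_le)
  have "ncsum w S = (\<Sum>X | X \<subseteq> S \<and> a \<in> X. w (card X) * (\<Prod>x\<in>X. ncsum w (gap S X x)))"
    by (rule ncsum_by_first_block[OF S(1) a])
  also have "\<dots> = (\<Sum>X\<in>Pow T. (w \<circ> Suc) (card X) * (\<Prod>x\<in>insert a X. h (card (gap T (insert a X) x))))"
  proof (rule sum.reindex_bij_witness[where i = "insert a" and j = "\<lambda>X. X - {a}"], goal_cases)
    case (5 X)
    then have X: "X \<subseteq> S" "a \<in> X" "finite X" using S(1) finite_subset by auto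
    have "(\<Prod>x\<in>X. ncsum w (gap S X x)) = (\<Prod>x\<in>X. h (card (gap T X x)))"
    proof (rule prod.cong[OF refl])
      fix x assume "x \<in> X"
      then have "gap S X x = gap T X x" using X a by (force simp: gap_def T_def)
      moreover have "gap T X x \<subset> S" using T a by (auto simp: gap_def)
      ultimately show "ncsum w (gap S X x) = h (card (gap T X x))" using h by simp
    qed
    moreover have "Suc (card (X - {a})) = card X" using X by (intro card_Suc_Diff1)
    ultimately show ?case using X by (simp add: insert_absorb)
  qed (use T in auto)
  also have "\<dots> = (Abs_fps h * (Abs_fps (w \<circ> Suc) oo (fps_X * Abs_fps h))) $ card T"
    by (rule gap_sum_fps[OF T(1,2)])
  also have "card T = card S - 1" using T by simp
  finally show ?thesis .
qed

lemma ncsum_eq_card: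
  assumes "finite S"
  shows "ncsum w S = ncsum w {..<card S}"
  using assms
proof (induction "card S" arbitrary: S rule: less_induct)
  case less
  show ?case
  proof (cases "S = {}")
    case False
    define h where "h = (\<lambda>n. ncsum w {..<n})"
    have h: "ncsum w R = h (card R)" if "R \<subset> S'" "finite S'" "card S' = card S" for R S'
    proof -
      have "card R < card S" using psubset_card_mono[OF that(2,1)] that(3) by simp
      moreover have "finite R" using that finite_subset by auto
      ultimately show ?thesis unfolding h_def by (rule less.hyps)
    qed
    have "card S > 0" using False less.prems by (simp add: card_gt_0_iff)
    then have "{..<card S} \<noteq> {}" by auto
    then have "ncsum w S = ncsum w {..<card S}"
      using ncsum_recurrence[of S w h] ncsum_recurrence[of "{..<card S}" w h] h False less.prems
      by simp
    then show ?thesis .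
  qed simp
qed

text \<open>
With \<open>A(y) = 1 + y U(y)\<close> the right-hand side is \<open>1 + x C U(x C)\<close>. Here \<open>x\<close> stands for the least
point, \<open>C\<close> for the gap after it, and \<open>U(x C)\<close> for the other points of its block with their gaps.
\<close>

theorem ncsum_fps:
  "Abs_fps (\<lambda>n. ncsum w {..<n}) = weight_fps w oo (fps_X * Abs_fps (\<lambda>n. ncsum w {..<n}))"
  (is "?C = _")
proof (rule fps_ext)
  fix n
  show "?C $ n = (weight_fps w oo (fps_X * ?C)) $ n"
  proof (cases n)
    case 0
    then show ?thesis by (simp add: weight_fps_def ncsum_empty)
  next
    case (Suc m)
    have "weight_fps w = 1 + fps_X * Abs_fps (w \<circ> Suc)"
      by (rule fps_ext) (simp add: weight_fps_def gr0_conv_Suc split: nat.split)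
    then have "weight_fps w oo (fps_X * ?C) = 1 + fps_X * (?C * (Abs_fps (w \<circ> Suc) oo (fps_X * ?C)))"
      by (simp add: fps_compose_add_distrib fps_compose_mult_distrib mult.assoc)
    then have "(weight_fps w oo (fps_X * ?C)) $ n = (?C * (Abs_fps (w \<circ> Suc) oo (fps_X * ?C))) $ m"
      by (simp add: Suc)
    also have "\<dots> = (?C * (Abs_fps (w \<circ> Suc) oo (fps_X * ?C))) $ (card {..<n} - 1)"
      by (simp add: Suc)
    also have "\<dots> = ncsum w {..<n}"
    proof (rule ncsum_recurrence[symmetric])
      show "ncsum w R = ncsum w {..<card R}" if "R \<subset> {..<n}" for R
        by (rule ncsum_eq_card) (use that finite_subset in auto)
    qed (auto simp: Suc)
    finally show ?thesis by simp
  qed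
qed

section \<open>The generating function of multichains\<close>

definition ncchains :: "nat set \<Rightarrow> nat \<Rightarrow> nat set set list set" where
  "ncchains S l = {Ps. length Ps = l \<and> set Ps \<subseteq> ncp S \<and> successively (refines S) Ps}"

definition chain_sum :: "(nat \<Rightarrow> real) \<Rightarrow> nat set \<Rightarrow> nat \<Rightarrow> real" where
  "chain_sum w S l = (\<Sum>Ps\<in>ncchains S l. \<Prod>B\<in>hd Ps. w (card B))"

lemma finite_ncchains:
  assumes "finite S"
  shows "finite (ncchains S l)"
proof (rule finite_subset)
  show "ncchains S l \<subseteq> {Ps. set Ps \<subseteq> ncp S \<and> length Ps = l}"
    unfolding ncchains_def by blast
  show "finite {Ps. set Ps \<subseteq> ncp S \<and> length Ps = l}"
    by (rule finite_lists_length_eq[OF finite_ncp[OF assms]])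
qed

lemma hd_ncchains:
  assumes "Ps \<in> ncchains S l" "l > 0"
  shows "hd Ps \<in> ncp S"
proof -
  have "Ps \<noteq> []" and sub: "set Ps \<subseteq> ncp S" using assms by (auto simp: ncchains_def)
  from hd_in_set[OF this(1)] sub show ?thesis by (rule rev_subsetD)
qed

text \<open>
Refining a noncrossing partition within noncrossing partitions means choosing a noncrossing partition
of each of its blocks.
\<close>

lemma sum_refinements:
  assumes S: "finite S" and Q: "Q \<in> ncp S"
  shows "(\<Sum>P | P \<in> ncp S \<and> refines S P Q. \<Prod>B\<in>P. w (card B)) = (\<Prod>D\<in>Q. ncsum w D)"
proof -
  have part: "partition_on S Q" "noncrossing Q" using Q by (auto simp: ncp_def)
  have "{P. P \<in> ncp S \<and> refines S P Q} =
    {P. P \<in> ncp (\<Union>D\<in>Q. id D) \<and> (\<forall>B\<in>P. \<exists>D\<in>Q. B \<subseteq> id D)}"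
    using part by (auto simp: ncp_def refines_def partition_onD1[OF part(1), symmetric])
  moreover have "(\<Sum>P | P \<in> ncp (\<Union>D\<in>Q. id D) \<and> (\<forall>B\<in>P. \<exists>D\<in>Q. B \<subseteq> id D). \<Prod>B\<in>P. w (card B)) =
    (\<Prod>D\<in>Q. \<Sum>P\<in>ncp (id D). \<Prod>B\<in>P. w (card B))"
  proof (rule sum_ncp_within)
    show "finite Q" by (rule finite_elements[OF S part(1)])
    show "finite (id D)" if "D \<in> Q" for D
      using that S part(1) by (auto simp: partition_on_def intro: finite_subset)
    show "disjoint_family_on id Q"
      using partition_onD2[OF part(1)] by (auto simp: disjoint_family_on_def disjoint_def)
    show "noncrossing_family id Q"
    proof (rule noncrossing_familyI)
      fix A B a b c d
      assume "A \<in> Q" "B \<in> Q" "A \<noteq> B" "a < b" "b < c" "c < d"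
        "a \<in> id A" "c \<in> id A" "b \<in> id B" "d \<in> id B"
      then show False using noncrossingD[OF part(2), of A B a b c d] by simp
    qed
  qed
  ultimately show ?thesis by (simp add: ncsum_def)
qed

lemma chain_sum_1: "chain_sum w S (Suc 0) = ncsum w S"
  unfolding chain_sum_def ncsum_def
  by (rule sum.reindex_bij_witness[where i = "\<lambda>P. [P]" and j = hd])
    (auto simp: ncchains_def length_Suc_conv)

text \<open>
Summing over the bottom element first replaces the weight of a block of the second element by the
weighted number of ways to partition that block. A chain thus becomes one element shorter at the
price of a new weight function, so later inductions have to leave \<open>w\<close> arbitrary.
\<close>

lemma chain_sum_Suc:
  assumes S: "finite S"
  shows "chain_sum w S (Suc (Suc l)) = chain_sum (\<lambda>n. ncsum w {..<n}) S (Suc l)"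
proof -
  let ?g = "\<lambda>P. \<Prod>B\<in>P. w (card B)"
  have "chain_sum w S (Suc (Suc l)) =
    (\<Sum>(Qs, P)\<in>(SIGMA Qs:ncchains S (Suc l). {P \<in> ncp S. refines S P (hd Qs)}). ?g P)"
    unfolding chain_sum_def
  proof (rule sum.reindex_bij_witness[where i = "\<lambda>(Qs, P). P # Qs" and j = "\<lambda>Ps. (tl Ps, hd Ps)"], goal_cases)
    case (2 Ps)
    then obtain P Q Qs where "Ps = P # Q # Qs" by (auto simp: ncchains_def length_Suc_conv)
    then show ?case using 2 by (auto simp: ncchains_def)
  next
    case (4 p)
    then obtain P Q Qs where "p = (Q # Qs, P)" by (cases p) (auto simp: ncchains_def length_Suc_conv)
    then show ?case using 4 by (auto simp: ncchains_def)
  qed (auto simp: ncchains_def length_Suc_conv)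
  also have "\<dots> = (\<Sum>Qs\<in>ncchains S (Suc l). \<Sum>P | P \<in> ncp S \<and> refines S P (hd Qs). ?g P)"
    by (subst sum.Sigma) (auto simp: finite_ncchains finite_ncp S)
  also have "\<dots> = (\<Sum>Qs\<in>ncchains S (Suc l). \<Prod>D\<in>hd Qs. ncsum w {..<card D})"
  proof (rule sum.cong[OF refl])
    fix Qs assume "Qs \<in> ncchains S (Suc l)"
    then have hd: "hd Qs \<in> ncp S" by (rule hd_ncchains) simp
    have "finite D" if "D \<in> hd Qs" for D
      using hd that S by (auto simp: ncp_def partition_on_def intro: finite_subset)
    then have "(\<Prod>D\<in>hd Qs. ncsum w D) = (\<Prod>D\<in>hd Qs. ncsum w {..<card D})"
      by (intro prod.cong ncsum_eq_card) auto
    then show "(\<Sum>P | P \<in> ncp S \<and> refines S P (hd Qs). ?g P) = (\<Prod>D\<in>hd Qs. ncsum w {..<card D})"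
      using sum_refinements[OF S hd] by simp
  qed
  finally show ?thesis by (simp add: chain_sum_def)
qed

text \<open>
Multichains of \<open>l + 1\<close> elements satisfy the functional equation of noncrossing partitions with
\<open>x C\<close> replaced by \<open>x G^(l+1)\<close>: if \<open>C(x) = A(x C(x))\<close> and, after the change of weights,
\<open>G(x) = C(x G(x)^l)\<close>, then \<open>G = A(x G^l C(x G^l)) = A(x G^(l+1))\<close>.
\<close>

theorem chain_sum_fps:
  defines "G \<equiv> \<lambda>w l. Abs_fps (\<lambda>N. chain_sum w {1..N} (Suc l))"
  shows "G w l = weight_fps w oo (fps_X * G w l ^ Suc l)"
proof (induction l arbitrary: w)
  case 0
  have "G w 0 = Abs_fps (\<lambda>n. ncsum w {..<n})"
    unfolding G_def chain_sum_1 by (rule fps_ext) (use ncsum_eq_card[of "{1.._}" w] in simp)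
  then show ?case using ncsum_fps[of w] by simp
next
  case (Suc l)
  let ?h = "\<lambda>n. ncsum w {..<n}"
  let ?C = "Abs_fps ?h"
  define F where "F = G w (Suc l)"
  have F: "F = G ?h l" by (rule fps_ext) (simp add: F_def G_def chain_sum_Suc)
  have C: "weight_fps ?h = ?C"
    by (rule fps_ext) (simp add: weight_fps_def ncsum_empty)
  have X0: "(fps_X * F ^ Suc l) $ 0 = 0" and C0: "(fps_X * ?C) $ 0 = 0" by simp_all
  have FC: "F = ?C oo (fps_X * F ^ Suc l)"
    using Suc.IH[of ?h] by (simp only: F C)
  also have "\<dots> = (weight_fps w oo (fps_X * ?C)) oo (fps_X * F ^ Suc l)"
    by (subst ncsum_fps) (rule refl)
  also have "\<dots> = weight_fps w oo ((fps_X * ?C) oo (fps_X * F ^ Suc l))"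
    by (rule fps_compose_assoc[OF X0 C0, symmetric])
  also have "(fps_X * ?C) oo (fps_X * F ^ Suc l) = fps_X * F ^ Suc l * F"
    by (simp only: fps_compose_mult_distrib[OF X0] fps_X_fps_compose_startby0[OF X0] FC[symmetric])
  also have "\<dots> = fps_X * F ^ Suc (Suc l)" by (simp add: mult_ac)
  finally show ?case by (simp only: F_def)
qed

section \<open>Lagrange inversion\<close>

text \<open>
This is Lagrange inversion for \<open>y = x G(x)^l\<close>, whose compositional inverse is \<open>x = q(y)\<close> with
\<open>q = y / A(y)^l\<close>, so that \<open>A = G \<circ> q\<close> is a power series in \<open>q\<close> with the coefficients of \<open>G\<close>. The
coefficient of \<open>q^N\<close> is the residue of \<open>A' / q^N\<close> divided by \<open>N\<close>, because \<open>(q^m)' / q^N\<close> is a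
derivative, hence without residue, unless \<open>m = N\<close>. The factor \<open>l * N + 1\<close> arises by
integrating \<open>A' * A^(l*N)\<close>. Writing \<open>1 / q^N = phi^N / y^N\<close> keeps the argument inside power series.
\<close>

lemma Lagrange_coefficient:
  fixes A G :: "'a::field_char_0 fps"
  assumes A0: "A $ 0 = 1" and G: "G = A oo (fps_X * G ^ l)"
  shows "of_nat (l * N + 1) * G $ N = (A ^ (l * N + 1)) $ N"
proof (cases "N = 0")
  case True
  have "G $ 0 = 1" using A0 by (subst G) simp
  then show ?thesis using True A0 by simp
next
  case False
  define p where "p = fps_X * G ^ l"
  define q where "q = fps_X * inverse A ^ l"
  define phi where "phi = A ^ l"
  have G0: "G $ 0 = 1" using A0 by (subst G) simp
  have p0: "p $ 0 = 0" and q0: "q $ 0 = 0" by (simp_all add: p_def q_def)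
  have p1: "p $ 1 = 1" using G0 by (simp add: p_def fps_power_zeroth)
  have qp: "q oo p = fps_X"
  proof -
    have "q oo p = p * (inverse A oo p) ^ l"
      by (simp add: q_def fps_compose_mult_distrib[OF p0] fps_compose_power[OF p0] p0)
    also have "inverse A oo p = inverse G"
      using fps_inverse_compose[OF p0, of A] A0 G by (simp add: p_def)
    also have "p * inverse G ^ l = fps_X * (G * inverse G) ^ l"
      by (simp add: p_def power_mult_distrib)
    also have "G * inverse G = 1"
      using G0 by (simp add: inverse_mult_eq_1')
    finally show ?thesis by simp
  qed
  have pq: "p oo q = fps_X"
  proof -
    have "(p oo q) oo p = fps_X oo p"
      using p0 by (simp add: fps_compose_assoc[OF p0 q0, symmetric] qp)
    then show ?thesis
      using fps_compose_inj_right[OF p0, of "p oo q" fps_X] p1 by simp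
  qed
  have Gq: "G oo q = A"
  proof -
    have "G oo q = (A oo p) oo q" using G by (simp add: p_def)
    also have "\<dots> = A" by (simp add: fps_compose_assoc[OF q0 p0, symmetric] pq)
    finally show ?thesis .
  qed
  have qphi: "q * phi = fps_X"
  proof -
    have "A * inverse A = 1" using A0 by (simp add: inverse_mult_eq_1')
    then show ?thesis
      by (simp add: q_def phi_def mult.assoc flip: power_mult_distrib) (simp add: mult.commute)
  qed
  \<comment> \<open>\<open>L F\<close> is the residue of the Laurent series \<open>F' / q^N\<close>.\<close>
  define L where "L = (\<lambda>F. (fps_X * fps_deriv F * phi ^ N) $ N)"
  have Xd: "(fps_X * fps_deriv F) $ n = of_nat n * F $ n" for F :: "'a fps" and n
    by (cases n) simp_all
  have L_sum: "L F = (\<Sum>n=0..N. of_nat n * F $ n * (phi ^ N) $ (N - n))" for F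
    unfolding L_def fps_mult_nth[of "fps_X * fps_deriv F"] Xd ..
  have Lq: "L (q ^ m) = (if m = N then of_nat N else 0)" if "m \<le> N" for m
  proof (cases "m = N")
    case True
    have "L (q ^ m) = (\<Sum>n\<in>{N}. of_nat n * (q ^ N) $ n * (phi ^ N) $ (N - n))"
      unfolding L_sum True
      by (rule sum.mono_neutral_right) (use q0 in \<open>auto simp: startsby_zero_power_prefix\<close>)
    also have "\<dots> = of_nat N * (q ^ N * phi ^ N) $ N"
      using q0 by (simp add: fps_mult_nth startsby_zero_power_prefix sum.atLeast0_atMost_Suc
        sum.remove[of "{0..N}" N])
    also have "\<dots> = of_nat N"
      by (simp add: qphi flip: power_mult_distrib)
    finally show ?thesis using True by simp
  next
    case False
    define j where "j = N - m"
    have j: "N = m + j" "j > 0" using False that by (auto simp: j_def)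
    have e1: "q ^ m * phi ^ N = fps_X ^ m * phi ^ j"
      by (simp add: j power_add qphi flip: mult.assoc power_mult_distrib)
    have e2: "fps_X * fps_deriv (q ^ m * phi ^ N) =
        fps_X * fps_deriv (q ^ m) * phi ^ N + fps_X * (q ^ m * fps_deriv (phi ^ N))"
      by (simp add: algebra_simps)
    have dpow: "fps_deriv (phi ^ N) = of_nat N * fps_deriv phi * phi ^ (N - 1)" for N
      by (rule fps_deriv_power')
    have e3: "q ^ m * phi ^ (N - 1) = fps_X ^ m * phi ^ (j - 1)"
    proof -
      have "N - 1 = m + (j - 1)" using j by simp
      then show ?thesis by (simp add: power_add qphi flip: mult.assoc power_mult_distrib)
    qed
    have "of_nat j * (q ^ m * fps_deriv (phi ^ N))
        = of_nat j * (of_nat N * fps_deriv phi * (q ^ m * phi ^ (N - 1)))"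
      unfolding dpow by (simp only: mult_ac)
    also have "\<dots> = of_nat N * (fps_X ^ m * fps_deriv (phi ^ j))"
      unfolding dpow e3 by (simp only: mult_ac)
    finally have e4: "of_nat j * (q ^ m * fps_deriv (phi ^ N))
        = of_nat N * (fps_X ^ m * fps_deriv (phi ^ j))" .
    have "of_nat j * (fps_X * (q ^ m * fps_deriv (phi ^ N))) $ N
        = (of_nat j * (fps_X * (q ^ m * fps_deriv (phi ^ N)))) $ N"
      by (simp add: fps_mult_of_nat_nth)
    also have "\<dots> = (of_nat N * (fps_X ^ m * (fps_X * fps_deriv (phi ^ j)))) $ N"
      using arg_cong[OF e4, of "\<lambda>F. fps_X * F"] by (simp only: mult_ac)
    also have "\<dots> = of_nat N * (fps_X ^ m * (fps_X * fps_deriv (phi ^ j))) $ N"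
      by (simp add: fps_mult_of_nat_nth)
    also have "\<dots> = of_nat N * (of_nat j * (phi ^ j) $ j)"
      by (subst fps_X_power_mult_nth) (simp add: j Xd)
    finally have "(fps_X * (q ^ m * fps_deriv (phi ^ N))) $ N = of_nat N * (phi ^ j) $ j"
      using j by simp
    moreover have "(fps_X * fps_deriv (q ^ m * phi ^ N)) $ N = of_nat N * (phi ^ j) $ j"
      unfolding Xd e1 by (simp add: fps_X_power_mult_nth j)
    ultimately have "L (q ^ m) = 0"
      unfolding e2 L_def fps_add_nth by (simp only: add_cancel_left_left)
    then show ?thesis using False by simp
  qed
  have "L A = (\<Sum>n=0..N. of_nat n * (\<Sum>m=0..N. G $ m * (q ^ m) $ n) * (phi ^ N) $ (N - n))"
  proof -
    have "A $ n = (\<Sum>m=0..N. G $ m * (q ^ m) $ n)" if "n \<le> N" for n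
    proof -
      have "A $ n = (G oo q) $ n" by (simp add: Gq)
      also have "\<dots> = (\<Sum>m=0..n. G $ m * (q ^ m) $ n)" by (simp add: fps_compose_nth)
      also have "\<dots> = (\<Sum>m=0..N. G $ m * (q ^ m) $ n)"
        by (rule sum.mono_neutral_left) (use that q0 in \<open>auto simp: startsby_zero_power_prefix\<close>)
      finally show ?thesis .
    qed
    then show ?thesis unfolding L_sum by simp
  qed
  also have "\<dots> = (\<Sum>m=0..N. G $ m * L (q ^ m))"
    unfolding L_sum sum_distrib_left sum_distrib_right
    by (subst sum.swap) (simp add: mult_ac)
  also have "\<dots> = (\<Sum>m\<in>{0..N}. if m = N then G $ m * of_nat N else 0)"
    by (rule sum.cong) (auto simp: Lq)
  also have "\<dots> = of_nat N * G $ N" by simp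
  finally have LA: "L A = of_nat N * G $ N" .
  have "of_nat (l * N + 1) * L A = (fps_X * fps_deriv (A ^ (l * N + 1))) $ N"
  proof -
    have "fps_X * fps_deriv (A ^ (l * N + 1)) = of_nat (l * N + 1) * (fps_X * fps_deriv A * (A ^ l) ^ N)"
      unfolding fps_deriv_power' by (simp add: mult_ac flip: power_mult)
    then show ?thesis by (simp only: L_def phi_def fps_mult_of_nat_nth)
  qed
  also have "\<dots> = of_nat N * (A ^ (l * N + 1)) $ N" by (rule Xd)
  finally show ?thesis using False by (simp add: LA)
qed

section \<open>Comparison of coefficients\<close>

text \<open>
Base \<open>b\<close> expansions are unique: the multiplicities are the digits, and they are smaller than \<open>b\<close>.
The induction compares leading digits, that is, the largest elements.
\<close>

lemma sum_powers_inj: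
  fixes M M' :: "nat multiset"
  assumes "size M < b" "size M' < b"
    and "(\<Sum>s\<in>#M. b ^ s) = (\<Sum>s\<in>#M'. b ^ s)"
  shows "M = M'"
  using assms
proof (induction "size M" arbitrary: M M')
  case 0
  then show ?case by (cases M') auto
next
  case (Suc n)
  let ?code = "\<lambda>M :: nat multiset. \<Sum>s\<in>#M. b ^ s"
  have b: "b > 0" using Suc.prems by auto
  have lower: "b ^ Max_mset M \<le> ?code M" if "M \<noteq> {#}" for M
  proof -
    have "Max_mset M \<in># M" using that by simp
    then obtain N where "M = add_mset (Max_mset M) N" by (metis mset_add)
    then have "?code M = b ^ Max_mset M + ?code N"
      by (metis image_mset_add_mset sum_mset.add_mset)
    then show ?thesis by simp
  qed
  have upper: "?code M < b ^ Suc (Max_mset M)" if "size M < b" for M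
  proof -
    have "?code M \<le> (\<Sum>s\<in>#M. b ^ Max_mset M)"
      using b by (intro sum_mset_mono) (auto intro!: power_increasing)
    also have "\<dots> = size M * b ^ Max_mset M" by simp
    also have "\<dots> < b * b ^ Max_mset M" using that b by simp
    finally show ?thesis by simp
  qed
  have M: "M \<noteq> {#}" using Suc by auto
  have M': "M' \<noteq> {#}"
    using lower[OF M] b Suc.prems(3) by auto
  have less: "\<not> Max_mset M < Max_mset M'" if "?code M = ?code M'" "size M < b" "M' \<noteq> {#}" for M M'
  proof
    assume "Max_mset M < Max_mset M'"
    then have "b ^ Suc (Max_mset M) \<le> b ^ Max_mset M'" using b by (intro power_increasing) auto
    then show False using upper[OF that(2)] lower[OF that(3)] that(1) by linarith
  qed
  have eq: "Max_mset M = Max_mset M'"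
    using less[OF Suc.prems(3,1) M'] less[OF Suc.prems(3)[symmetric] Suc.prems(2) M] by simp
  have "Max_mset M \<in># M" "Max_mset M \<in># M'" using M M' by (simp, simp add: eq)
  then obtain N N' where N: "M = add_mset (Max_mset M) N" "M' = add_mset (Max_mset M) N'"
    by (metis mset_add)
  have "N = N'"
  proof (rule Suc.hyps(1))
    show "n = size N" using Suc.hyps(2) N(1) by (metis Suc_inject size_add_mset)
    show "size N < b" using Suc.prems(1) N(1) by (metis Suc_lessD size_add_mset)
    show "size N' < b" using Suc.prems(2) N(2) by (metis Suc_lessD size_add_mset)
    have "?code M = b ^ Max_mset M + ?code N" "?code M' = b ^ Max_mset M + ?code N'"
      using N by (metis image_mset_add_mset sum_mset.add_mset)+
    then show "?code N = ?code N'" using Suc.prems(3) by simp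
  qed
  then show ?case using N by simp
qed

text \<open>
Comparison of coefficients in an identity of multivariate polynomials in the variables \<open>w 0, w 1, \<dots>\<close>.
The substitution \<open>w s = t^(b^s)\<close> reduces it to univariate polynomials; for \<open>b\<close> exceeding the
sizes of all multisets involved it maps distinct monomials to distinct powers of \<open>t\<close>.
\<close>

lemma count_eq_of_weighted_sums_eq:
  fixes f :: "'a \<Rightarrow> nat multiset" and g :: "'b \<Rightarrow> nat multiset"
  assumes fin: "finite A" "finite B"
    and eq: "\<And>w :: nat \<Rightarrow> real. real c * (\<Sum>x\<in>A. \<Prod>s\<in>#f x. w s) = (\<Sum>y\<in>B. \<Prod>s\<in>#g y. w s)"
  shows "c * card {x \<in> A. f x = \<mu>} = card {y \<in> B. g y = \<mu>}"
proof -
  define b where "b = Suc (size \<mu> + (\<Sum>x\<in>A. size (f x)) + (\<Sum>y\<in>B. size (g y)))"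
  define code where "code = (\<lambda>M :: nat multiset. \<Sum>s\<in>#M. b ^ s)"
  have code_f: "code (f x) = code \<mu> \<longleftrightarrow> f x = \<mu>" if "x \<in> A" for x
  proof -
    have "size (f x) < b" using member_le_sum[of x A "\<lambda>x. size (f x)"] that fin by (simp add: b_def)
    then show ?thesis using sum_powers_inj[of "f x" b \<mu>] by (auto simp: code_def b_def)
  qed
  have code_g: "code (g y) = code \<mu> \<longleftrightarrow> g y = \<mu>" if "y \<in> B" for y
  proof -
    have "size (g y) < b" using member_le_sum[of y B "\<lambda>x. size (g x)"] that fin by (simp add: b_def)
    then show ?thesis using sum_powers_inj[of "g y" b \<mu>] by (auto simp: code_def b_def)
  qed
  have monomial: "(\<Prod>s\<in>#M. t ^ (b ^ s)) = t ^ code M" for M and t :: real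
    by (induction M) (simp_all add: code_def power_add)
  define p :: "real poly" where "p = smult (real c) (\<Sum>x\<in>A. monom 1 (code (f x)))"
  define q :: "real poly" where "q = (\<Sum>y\<in>B. monom 1 (code (g y)))"
  have "poly p t = poly q t" for t
    using eq[of "\<lambda>s. t ^ (b ^ s)"] by (simp add: p_def q_def poly_sum poly_monom monomial)
  then have "p = q" by (simp add: poly_eq_poly_eq_iff[symmetric] fun_eq_iff)
  then have "coeff p (code \<mu>) = coeff q (code \<mu>)" by simp
  moreover have "coeff p (code \<mu>) = real c * (\<Sum>x\<in>A. if f x = \<mu> then 1 else 0)"
    using code_f by (simp add: p_def coeff_sum cong: sum.cong)
  moreover have "coeff q (code \<mu>) = (\<Sum>y\<in>B. if g y = \<mu> then 1 else 0)"
    using code_g by (simp add: q_def coeff_sum cong: sum.cong)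
  ultimately have "real c * real (card {x \<in> A. f x = \<mu>}) = real (card {y \<in> B. g y = \<mu>})"
    using fin by (simp add: sum.If_cases Int_def)
  then have "real (c * card {x \<in> A. f x = \<mu>}) = real (card {y \<in> B. g y = \<mu>})" by simp
  then show ?thesis by (simp only: of_nat_eq_iff)
qed

section \<open>Counting multichains by the block sizes of the bottom element\<close>

lemma fps_power_nth_weights:
  assumes "R > 0"
  shows "(weight_fps w ^ R) $ N =
    (\<Sum>v\<in>natpermute N R. \<Prod>s\<in>#filter_mset ((<) 0) (mset v). w s)"
proof -
  let ?f = "\<lambda>s. if s = 0 then 1 else w s"
  have "(weight_fps w ^ R) $ N = (\<Sum>v\<in>natpermute N R. \<Prod>j=0..R - 1. ?f (v ! j))"
    using assms unfolding weight_fps_def by (subst fps_power_nth) simp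
  also have "\<dots> = (\<Sum>v\<in>natpermute N R. \<Prod>s\<in>#filter_mset ((<) 0) (mset v). w s)"
  proof (rule sum.cong[OF refl])
    fix v assume "v \<in> natpermute N R"
    then have "length v = R" by (simp add: natpermute_def)
    then have "{0..R - 1} = {0..<length v}" using assms by (cases R) auto
    then have "(\<Prod>j=0..R - 1. ?f (v ! j)) = prod_list (map ?f v)"
      unfolding prod.list_conv_set_nth by (intro prod.cong) auto
    also have "\<dots> = (\<Prod>s\<in>#filter_mset ((<) 0) (mset v). w s)"
      by (induction v) auto
    finally show "(\<Prod>j=0..R - 1. ?f (v ! j)) = (\<Prod>s\<in>#filter_mset ((<) 0) (mset v). w s)" .
  qed
  finally show ?thesis .
qed

text \<open>
Such lists are the arrangements of the multiset consisting of \<open>\<mu>\<close> and \<open>R - size \<mu>\<close> zeros.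
\<close>

lemma card_natpermute_nonzero_parts:
  assumes \<mu>: "integer_partition \<mu> N" and R: "size \<mu> < R"
  shows "card {v \<in> natpermute N R. filter_mset ((<) 0) (mset v) = \<mu>} *
    (part_mult \<mu> * fact (R - size \<mu>)) = fact R"
proof -
  define M where "M = \<mu> + replicate_mset (R - size \<mu>) 0"
  have \<mu>0: "0 \<notin># \<mu>" "sum_mset \<mu> = N" using \<mu> by (auto simp: integer_partition_def)
  have filter\<mu>: "filter_mset ((<) 0) \<mu> = \<mu>"
    using \<mu>0(1) by (simp add: filter_mset_eq_conv) (metis gr0I)
  have "{v \<in> natpermute N R. filter_mset ((<) 0) (mset v) = \<mu>} = permutations_of_multiset M"
  proof safe
    fix v assume v: "v \<in> natpermute N R" and f: "\<mu> = filter_mset ((<) 0) (mset v)"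
    have "mset v = filter_mset ((<) 0) (mset v) + filter_mset (\<lambda>s. \<not> 0 < s) (mset v)"
      by (rule multiset_partition)
    also have "filter_mset (\<lambda>s. \<not> 0 < s) (mset v) = replicate_mset (count (mset v) 0) 0"
      by (simp add: filter_eq_replicate_mset[symmetric] eq_commute)
    finally have e: "mset v = \<mu> + replicate_mset (count (mset v) 0) 0" using f by simp
    have "size (mset v) = R" using v by (simp add: natpermute_def)
    then have "count (mset v) 0 = R - size \<mu>" using arg_cong[OF e, of size] by simp
    then show "v \<in> permutations_of_multiset M" using e by (simp add: M_def permutations_of_multiset_def)
  next
    fix v assume "v \<in> permutations_of_multiset M"
    then have v: "mset v = M" by (simp add: permutations_of_multiset_def)
    have "length v = R" using arg_cong[OF v, of size] R by (simp add: M_def)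
    moreover have "sum_list v = N"
      using arg_cong[OF v, of sum_mset] \<mu>0 by (simp add: M_def sum_mset_sum_list)
    ultimately show "v \<in> natpermute N R" by (simp add: natpermute_def)
    show "filter_mset ((<) 0) (mset v) = \<mu>"
      by (simp add: v M_def filter\<mu>)
  qed
  moreover have "(\<Prod>x\<in>set_mset M. fact (count M x) :: nat) = fact (R - size \<mu>) * part_mult \<mu>"
  proof -
    have "set_mset M = insert 0 (set_mset \<mu>)" using R by (auto simp: M_def)
    moreover have "(\<Prod>x\<in>set_mset \<mu>. fact (count M x) :: nat) = part_mult \<mu>"
      unfolding part_mult_def using \<mu>0(1) by (intro prod.cong) (auto simp: M_def)
    moreover have "count M 0 = R - size \<mu>" using \<mu>0(1) by (simp add: M_def not_in_iff)
    ultimately show ?thesis using \<mu>0(1) by simp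
  qed
  moreover have "size M = R" using R by (simp add: M_def)
  ultimately show ?thesis using card_permutations_of_multiset_aux[of M] by (simp add: mult_ac)
qed

lemma size_le_of_integer_partition:
  assumes "integer_partition \<mu> N"
  shows "size \<mu> \<le> N"
proof -
  have "(\<Sum>s\<in>#\<mu>. 1) \<le> (\<Sum>s\<in>#\<mu>. s)"
    using assms by (intro sum_mset_mono) (auto simp: integer_partition_def Suc_le_eq intro: gr0I)
  then show ?thesis using assms by (simp add: integer_partition_def)
qed

definition block_sizes :: "nat set set \<Rightarrow> nat multiset" where
  "block_sizes P = image_mset card (mset_set P)"

text \<open>
Both sides of the Lagrange formula are polynomials in the weights. On the left the monomial of \<open>\<mu>\<close>
collects the multichains whose bottom element has block sizes \<open>\<mu>\<close>, on the right the lists of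
\<open>l * N + 1\<close> numbers whose nonzero entries form \<open>\<mu>\<close>.
\<close>

theorem card_ncchains_of_block_sizes:
  assumes \<mu>: "integer_partition \<mu> N" and l: "l > 0"
  shows "card {Ps \<in> ncchains {1..N} l. block_sizes (hd Ps) = \<mu>} *
    (part_mult \<mu> * fact (l * N + 1 - size \<mu>)) = fact (l * N)"
proof -
  define R where "R = l * N + 1"
  have sum: "real R * (\<Sum>Ps\<in>ncchains {1..N} l. \<Prod>s\<in>#block_sizes (hd Ps). w s) =
      (\<Sum>v\<in>natpermute N R. \<Prod>s\<in>#filter_mset ((<) 0) (mset v). w s)" for w :: "nat \<Rightarrow> real"
  proof -
    obtain l' where l': "l = Suc l'" using l gr0_conv_Suc by auto
    define G where "G = Abs_fps (\<lambda>N. chain_sum w {1..N} l)"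
    have "weight_fps w $ 0 = 1" by (simp add: weight_fps_def)
    moreover have "G = weight_fps w oo (fps_X * G ^ l)"
      unfolding G_def l' by (rule chain_sum_fps)
    ultimately have "real R * G $ N = (weight_fps w ^ R) $ N"
      unfolding R_def by (rule Lagrange_coefficient)
    also have "G $ N = (\<Sum>Ps\<in>ncchains {1..N} l. \<Prod>s\<in>#block_sizes (hd Ps). w s)"
      by (simp add: G_def chain_sum_def block_sizes_def image_mset.compositionality comp_def
        prod_unfold_prod_mset)
    also have "(weight_fps w ^ R) $ N = (\<Sum>v\<in>natpermute N R. \<Prod>s\<in>#filter_mset ((<) 0) (mset v). w s)"
      by (rule fps_power_nth_weights) (simp add: R_def)
    finally show ?thesis .
  qed
  have count: "R * card {Ps \<in> ncchains {1..N} l. block_sizes (hd Ps) = \<mu>} =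
      card {v \<in> natpermute N R. filter_mset ((<) 0) (mset v) = \<mu>}"
    by (rule count_eq_of_weighted_sums_eq[OF finite_ncchains natpermute_finite sum]) simp
  have "size \<mu> \<le> N" by (rule size_le_of_integer_partition[OF \<mu>])
  also have "\<dots> \<le> l * N" using l by simp
  finally have "size \<mu> < R" by (simp add: R_def)
  note card_natpermute_nonzero_parts[OF \<mu> this]
  also have "fact R = R * fact (l * N)" by (simp add: R_def)
  finally have "R * (card {Ps \<in> ncchains {1..N} l. block_sizes (hd Ps) = \<mu>} *
      (part_mult \<mu> * fact (R - size \<mu>))) = R * fact (l * N)"
    unfolding count[symmetric] mult.assoc .
  moreover have "R \<noteq> 0" by (simp add: R_def)
  ultimately show ?thesis unfolding mult_cancel1 by (simp add: R_def)
qed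

section \<open>Block sizes divisible by a given number\<close>

lemma refines_preserves_dvd_card:
  assumes S: "finite S" and ref: "refines S P Q" and P: "\<And>B. B \<in> P \<Longrightarrow> k dvd card B" and D: "D \<in> Q"
  shows "k dvd card D"
proof -
  define p where "p = {B \<in> P. B \<subseteq> D}"
  have p: "p \<subseteq> P" "partition_on D p"
    using refines_obtains_subset[OF ref D] unfolding p_def by (blast, assumption)
  have "D \<subseteq> S" using D ref by (auto simp: refines_def partition_on_def)
  then have "finite D" using S finite_subset by blast
  then have "card D = (\<Sum>B\<in>p. card B)" using sum.partition[OF _ p(2), of "\<lambda>_. 1 :: nat"] by simp
  then show ?thesis using P p(1) by (auto intro!: dvd_sum)
qed

text \<open>
Divisibility of the block sizes by \<open>k\<close> is inherited by coarser partitions, so it only constrains the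
bottom element, where it is part of the prescribed type. The count for \<open>k\<close> and \<open>lam\<close> is
therefore that for ordinary noncrossing partitions and the block sizes \<open>k * s\<close>, \<open>s\<close> in \<open>lam\<close>.
\<close>

lemma multichains_ktype_eq:
  assumes l: "l > 0" and k: "k > 0"
  shows "{Ps \<in> multichains k n l. ktype k (hd Ps) = lam} =
    {Ps \<in> ncchains {1..k * n} l. block_sizes (hd Ps) = image_mset ((*) k) lam}"
proof -
  have sub: "NC k n = {P \<in> ncp {1..k * n}. \<forall>B\<in>P. k dvd card B}"
    by (simp add: NC_def ncp_def conj_assoc)
  have ktype: "ktype k P = image_mset (\<lambda>s. s div k) (block_sizes P)" for P
    by (simp add: ktype_def block_sizes_def image_mset.compositionality comp_def)
  have sizes: "block_sizes P = image_mset ((*) k) (ktype k P)" if "P \<in> NC k n" for P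
  proof -
    have "finite P" using that by (auto simp: NC_def intro: finite_elements[of "{1..k * n}"])
    then show ?thesis
      using that by (auto simp: ktype_def block_sizes_def image_mset.compositionality sub intro!: image_mset_cong)
  qed
  show ?thesis
  proof safe
    fix Ps assume Ps: "Ps \<in> multichains k n l"
    then show "Ps \<in> ncchains {1..k * n} l" by (auto simp: multichains_def ncchains_def sub)
    have "hd Ps \<in> NC k n" using Ps l by (cases Ps) (auto simp: multichains_def)
    then show "block_sizes (hd Ps) = image_mset ((*) k) (ktype k (hd Ps))" by (rule sizes)
  next
    fix Ps assume Ps: "Ps \<in> ncchains {1..k * n} l"
      and lam: "block_sizes (hd Ps) = image_mset ((*) k) lam"
    then show "ktype k (hd Ps) = lam"
      using k by (simp add: ktype image_mset.compositionality comp_def)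
    obtain P Qs where PQ: "Ps = P # Qs" using Ps l by (cases Ps) (auto simp: ncchains_def)
    have "finite P" using Ps by (auto simp: PQ ncchains_def ncp_def intro: finite_elements[of "{1..k * n}"])
    then have dvd: "k dvd card B" if "B \<in> P" for B
    proof -
      have "card B \<in># block_sizes P" using that \<open>finite P\<close> by (simp add: block_sizes_def)
      then show ?thesis using lam by (auto simp: PQ)
    qed
    have "transp (refines {1..k * n})" by (rule transpI) (rule refines_trans)
    then have "sorted_wrt (refines {1..k * n}) (P # Qs)"
      using Ps by (simp add: PQ ncchains_def successively_conv_sorted_wrt)
    then have "k dvd card D" if "Q \<in> set Ps" "D \<in> Q" for Q D
      using that dvd refines_preserves_dvd_card[of "{1..k * n}" P Q k D] by (auto simp: PQ)
    then show "Ps \<in> multichains k n l"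
      using Ps by (auto simp: multichains_def ncchains_def sub)
  qed
qed

lemma integer_partition_scale:
  assumes "k > 0" "integer_partition lam n"
  shows "integer_partition (image_mset ((*) k) lam) (k * n)"
proof -
  have "sum_mset (image_mset ((*) k) lam) = k * sum_mset lam"
    by (induction lam) (simp_all add: distrib_left)
  then show ?thesis using assms by (auto simp: integer_partition_def)
qed

lemma part_mult_scale:
  assumes "k > 0"
  shows "part_mult (image_mset ((*) k) lam) = part_mult lam"
proof -
  have inj: "inj ((*) k)" using assms by (auto intro: injI)
  have "count (image_mset ((*) k) lam) (k * s) = count lam s" for s
    using assms by (induction lam) auto
  then show ?thesis
    unfolding part_mult_def set_image_mset prod.reindex[OF inj_on_subset[OF inj subset_UNIV]]
    by simp
qed

theorem theorem4p4p4:
  fixes k l n i :: nat and lam :: "nat multiset"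
  assumes "k > 0" and "l > 0" and "n > 0"
    and "integer_partition lam n" and "size lam = i"
  shows "real (card {Ps \<in> multichains k n l. ktype k (hd Ps) = lam}) =
    fact (k * l * n) / (real (part_mult lam) * fact (k * l * n - i + 1))"
proof -
  \<comment> \<open>The bound on \<open>i\<close> lets the \<open>+ 1\<close> move past the truncated subtraction.\<close>
  have "i \<le> n" using size_le_of_integer_partition[OF assms(4)] assms(5) by simp
  also have "n \<le> k * l * n" using assms by simp
  finally have e: "l * (k * n) + 1 - i = k * l * n - i + 1" by (simp add: mult_ac)
  let ?c = "card {Ps \<in> multichains k n l. ktype k (hd Ps) = lam}"
  have "?c * (part_mult lam * fact (l * (k * n) + 1 - i)) = fact (l * (k * n))"
    using card_ncchains_of_block_sizes[OF integer_partition_scale[OF assms(1,4)] assms(2)]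
    unfolding multichains_ktype_eq[OF assms(2,1)] part_mult_scale[OF assms(1)] size_image_mset assms(5) .
  then have "?c * (part_mult lam * fact (k * l * n - i + 1)) = fact (k * l * n)"
    unfolding e by (simp only: mult_ac)
  then have "real (?c * (part_mult lam * fact (k * l * n - i + 1))) = real (fact (k * l * n))"
    by (simp only:)
  then have "real ?c * (real (part_mult lam) * fact (k * l * n - i + 1)) = fact (k * l * n)"
    by (simp only: of_nat_mult of_nat_fact)
  moreover have "real (part_mult lam) * fact (k * l * n - i + 1) \<noteq> 0"
    by (simp add: part_mult_def)
  ultimately show ?thesis by (simp only: eq_divide_eq if_True if_False simp_thms)
qed

end
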